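(* There exist constants $\lambda,c>0$ such that for every $f\in BMO(\mathbb{R}^2)$ with $\|f\|_{BMO(\mathbb{R}^2)}=1$, for any sequence of intervals $I_k\subset\mathbb{R}$ ($k\ge1$) with $l(I_k)=2^k$, and for any interval $J\subset\mathbb{R}$ with $l(J)=1$, $$\int_J \exp\left(\lambda\,\sup_{k\ge1}\frac{O(f_y,I_k)}{k}\right)dy\le c .$$
   Context: For a locally integrable function $g$ on $\mathbb{R}^d$ and a measurable set $A\subset\mathbb{R}^d$ of positive finite measure, $g_A=\frac{1}{|A|}\int_A g$ and $O(g,A)=\frac{1}{|A|}\int_A|g-g_A|$. $BMO(\mathbb{R}^2)$ is the space of $f\in L^1_{loc}(\mathbb{R}^2)$ with $\|f\|_{BMO(\mathbb{R}^2)}=\sup_Q O(f,Q)<\infty$, the supremum over all closed squares $Q$ with sides parallel to the axes. For $f$ on $\mathbb{R}^2$, $f_y$ denotes the horizontal slice $f_y(x)=f(x,y)$ (locally integrable on $\mathbb{R}$ for almost every $y$). $l(I)$ denotes the length of an interval $I$. *)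

theory Defs
  imports "HOL-Analysis.Analysis"
begin

definition locally_integrable :: "('a::euclidean_space \<Rightarrow> real) \<Rightarrow> bool" where
  "locally_integrable g \<longleftrightarrow> (\<forall>K. compact K \<longrightarrow> set_integrable lebesgue K g)"

definition average :: "('a::euclidean_space \<Rightarrow> real) \<Rightarrow> 'a set \<Rightarrow> real" where
  "average g A = 1 / measure lebesgue A * (LINT x:A|lebesgue. g x)"

definition mean_osc :: "('a::euclidean_space \<Rightarrow> real) \<Rightarrow> 'a set \<Rightarrow> real" where
  "mean_osc g A = 1 / measure lebesgue A * (LINT x:A|lebesgue. \<bar>g x - average g A\<bar>)"

definition squares :: "(real \<times> real) set set" where
  "squares = {{a..a + s} \<times> {b..b + s} | a b s. 0 < s}"

definition bmo_norm :: "(real \<times> real \<Rightarrow> real) \<Rightarrow> ereal" where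
  "bmo_norm f = (SUP Q\<in>squares. ereal (mean_osc f Q))"

definition BMO :: "(real \<times> real \<Rightarrow> real) set" where
  "BMO = {f. locally_integrable f \<and> bmo_norm f < \<infinity>}"

definition hslice :: "(real \<times> real \<Rightarrow> real) \<Rightarrow> real \<Rightarrow> real \<Rightarrow> real" where
  "hslice f y = (\<lambda>x. f (x, y))"

text \<open>The length of an interval is its Lebesgue measure. For positive \<open>l\<close> the
  equation excludes unbounded intervals, because \<^const>\<open>measure\<close> is \<open>0\<close> on sets of
  infinite measure. Endpoints may or may not belong to the interval.\<close>

definition interval_of_length :: "real \<Rightarrow> real set \<Rightarrow> bool" where
  "interval_of_length l S \<longleftrightarrow> is_interval S \<and> measure lebesgue S = l"

text \<open>The continuous extension of the exponential function to the extended reals; it is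
  needed because the supremum under the exponential may be infinite at some points.\<close>

definition exp_ext :: "ereal \<Rightarrow> ennreal" where
  "exp_ext t = (case t of ereal r \<Rightarrow> ennreal (exp r) | PInfty \<Rightarrow> \<infinity> | MInfty \<Rightarrow> 0)"

end

theory Submission
  imports Defs
begin

text \<open>
  Let \<open>f\<close> have norm \<open>1\<close> and let \<open>Q\<^sub>k\<close> be a square of side \<open>2\<^sup>k\<close> that contains
  \<open>I\<^sub>k \<times> J\<close>. The oscillation of a slice is at most twice the average of \<open>\<bar>f\<^sub>y - c\<^sub>k\<bar>\<close> over
  \<open>I\<^sub>k\<close>, where \<open>c\<^sub>k\<close> is the average of \<open>f\<close> over \<open>Q\<^sub>k\<close>. By Jensen's inequality, Fubini's theorem and
  the John--Nirenberg inequality on \<open>Q\<^sub>k\<close>,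
  the integral over \<open>J\<close> of \<open>exp (\<mu>/2 * O(f\<^sub>y, I\<^sub>k))\<close> is at most
  \<open>5 * \<bar>Q\<^sub>k\<bar> / 2\<^sup>k = 5 * 2\<^sup>k\<close>. This grows with \<open>k\<close>, because the
  rectangle \<open>I\<^sub>k \<times> J\<close> is a small part of the square. The division of the oscillation by \<open>k\<close>
  compensates for the growth: \<open>exp (v / k) \<le> 4 + 4 * 4\<^sup>-\<^sup>k * exp v\<close>
  (lemma \<open>exp_divide_le\<close>). Hence the supremum over \<open>k\<close> may be replaced by the sum
  over \<open>k\<close>, and the integrals of the terms form a convergent geometric series.

  The analytic core is thus the John--Nirenberg inequality in its exponential form
  (\<open>john_nirenberg_square\<close>). The stopping-time argument is carried out on dyadic
  averages only, as an induction on the number of generations (\<open>dyadic_exp_bound\<close>). The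
  return from the averages to \<open>f\<close> takes place in the mean: the mean over
  all descendants of generation \<open>n\<close> of the oscillation of \<open>f\<close> becomes arbitrarily small
  (\<open>dyadic_mean_mean_osc_small\<close>), which is enough for Lipschitz truncations of the
  exponential (\<open>average_lipschitz_le\<close>), and the truncation is then removed by monotone
  convergence.
\<close>

section \<open>Averages and mean oscillation\<close>

lemma average_const:
  assumes "S \<in> lmeasurable" "0 < measure lebesgue S"
  shows "average (\<lambda>x. c) S = c"
  using assms by (simp add: average_def set_lebesgue_integral_def field_simps fmeasurable_def)

lemma average_mono:
  assumes "set_integrable lebesgue S f" "set_integrable lebesgue S g" "\<And>x. x \<in> S \<Longrightarrow> f x \<le> g x"
  shows "average f S \<le> average g S"
  unfolding average_def using set_integral_mono[OF assms] by (simp add: mult_left_mono divide_right_mono)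

lemma average_add:
  assumes "set_integrable lebesgue S f" "set_integrable lebesgue S g"
  shows "average (\<lambda>x. f x + g x) S = average f S + average g S"
  using set_integral_add(2)[OF assms] by (simp add: average_def add_divide_distrib)

lemma average_diff:
  assumes "set_integrable lebesgue S f" "set_integrable lebesgue S g"
  shows "average (\<lambda>x. f x - g x) S = average f S - average g S"
  using set_integral_diff(2)[OF assms] by (simp add: average_def diff_divide_distrib)

lemma average_cmult: "average (\<lambda>x. c * f x) S = c * average f S"
  by (simp add: average_def)

lemma average_nonneg:
  assumes "\<And>x. 0 \<le> f x"
  shows "0 \<le> average f S"
  unfolding average_def set_lebesgue_integral_def
  by (intro mult_nonneg_nonneg Bochner_Integration.integral_nonneg) (auto simp: assms)

lemma mean_osc_eq_average: "mean_osc f S = average (\<lambda>x. \<bar>f x - average f S\<bar>) S"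
  by (simp add: mean_osc_def average_def)

lemma set_integrable_const_lmeasurable:
  fixes c :: real
  assumes "S \<in> lmeasurable"
  shows "set_integrable lebesgue S (\<lambda>x. c)"
  using assms unfolding set_integrable_def fmeasurable_def by (auto intro!: integrable_real_indicator)

lemma abs_average_minus_le:
  assumes "S \<in> lmeasurable" "0 < measure lebesgue S" "set_integrable lebesgue S f"
  shows "\<bar>average f S - a\<bar> \<le> average (\<lambda>x. \<bar>f x - a\<bar>) S"
proof -
  have c: "set_integrable lebesgue S (\<lambda>x. a)"
    by (rule set_integrable_const_lmeasurable[OF assms(1)])
  have d: "set_integrable lebesgue S (\<lambda>x. f x - a)"
    by (rule set_integral_diff(1)[OF assms(3) c])
  have e: "average f S - a = average (\<lambda>x. f x - a) S"
    using average_diff[OF assms(3) c] average_const[OF assms(1,2)] by simp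
  have 1: "average (\<lambda>x. f x - a) S \<le> average (\<lambda>x. \<bar>f x - a\<bar>) S"
    by (rule average_mono[OF d set_integrable_abs[OF d]]) auto
  have "average (\<lambda>x. (-1) * (f x - a)) S \<le> average (\<lambda>x. \<bar>f x - a\<bar>) S"
    by (rule average_mono[OF set_integrable_mult_right[OF d] set_integrable_abs[OF d]]) auto
  then have 2: "- average (\<lambda>x. f x - a) S \<le> average (\<lambda>x. \<bar>f x - a\<bar>) S"
    unfolding average_cmult by simp
  show ?thesis using 1 2 e by simp
qed

section \<open>Squares and dyadic means\<close>

definition square :: "real \<Rightarrow> real \<Rightarrow> real \<Rightarrow> (real \<times> real) set" where
  "square a b s = {a..a + s} \<times> {b..b + s}"

lemma square_eq_cbox: "square a b s = cbox (a, b) (a + s, b + s)"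
  by (auto simp: square_def cbox_Pair_eq)

lemma square_lmeasurable [simp]: "square a b s \<in> lmeasurable"
  by (simp add: square_eq_cbox)

lemma measure_square: "0 \<le> s \<Longrightarrow> measure lebesgue (square a b s) = s\<^sup>2"
  by (simp add: square_eq_cbox content_Pair power2_eq_square)

lemma measure_square_pos: "0 < s \<Longrightarrow> 0 < measure lebesgue (square a b s)"
  by (simp add: measure_square)

lemma square_sets_lebesgue [measurable, simp]: "square a b s \<in> sets lebesgue"
  using fmeasurableD square_lmeasurable by blast

lemma set_integrable_square:
  "locally_integrable g \<Longrightarrow> set_integrable lebesgue (square a b s) g"
  by (simp add: locally_integrable_def square_eq_cbox)

lemma locally_integrable_abs_minus:
  fixes a :: real
  assumes "locally_integrable g"
  shows "locally_integrable (\<lambda>x. \<bar>g x - a\<bar>)"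
  unfolding locally_integrable_def
proof (intro allI impI)
  fix K :: "'a set" assume K: "compact K"
  show "set_integrable lebesgue K (\<lambda>x. \<bar>g x - a\<bar>)"
    using K assms by (intro set_integrable_abs set_integral_diff(1) set_integrable_const_lmeasurable)
      (auto simp: locally_integrable_def lmeasurable_compact)
qed

lemma average_children:
  assumes "set_integrable lebesgue (square a b s) g" "0 < s"
  shows "average g (square a b s) = (average g (square a b (s/2)) + average g (square (a + s/2) b (s/2))
     + average g (square a (b + s/2) (s/2)) + average g (square (a + s/2) (b + s/2) (s/2))) / 4"
proof -
  let ?h = "s/2"
  let ?L = "{a..a + ?h} \<times> {b..b + s}" and ?R = "{a + ?h..a + s} \<times> {b..b + s}"
  have null: "AE x in lebesgue. \<not> (x \<in> A \<and> x \<in> B)" if "A \<inter> B \<subseteq> {x. x \<bullet> i = c}" "i \<in> Basis" for A B c and i :: "real \<times> real"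
  proof -
    have "AE x in lebesgue. x \<bullet> i \<noteq> c"
      by (rule AE_completion[OF AE_lborel_inner_neq[OF that(2)]])
    then show ?thesis by eventually_elim (use that in auto)
  qed
  have meas: "{u..v} \<times> {w..z} \<in> sets lebesgue" for u v w z :: real
    using fmeasurableD[OF lmeasurable_cbox, of "(u,w)" "(v,z)"] by (simp add: cbox_Pair_eq)
  have int: "set_integrable lebesgue ({u..v} \<times> {w..z}) g" if "{u..v} \<times> {w..z} \<subseteq> square a b s" for u v w z :: real
    using set_integrable_subset[OF assms(1) meas that] .
  have split: "(LINT x:C|lebesgue. g x) = (LINT x:A|lebesgue. g x) + (LINT x:B|lebesgue. g x)"
    if "C = A \<union> B" "A \<inter> B \<subseteq> {x. x \<bullet> i = c}" "i \<in> Basis" "A = {u..v} \<times> {w..z}" "B = {u'..v'} \<times> {w'..z'}"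
       "A \<subseteq> square a b s" "B \<subseteq> square a b s" for A B C c u v w z u' v' w' z' and i :: "real \<times> real"
    unfolding that(1)
    using null[OF that(2,3)] that meas int by (intro set_integral_Un_AE) auto
  have 1: "(LINT x:square a b s|lebesgue. g x) = (LINT x:?L|lebesgue. g x) + (LINT x:?R|lebesgue. g x)"
    by (rule split[where i="(1,0)" and c="a + ?h"]) (use assms(2) in \<open>auto simp: square_def Basis_prod_def\<close>)
  have 2: "(LINT x:?L|lebesgue. g x) = (LINT x:square a b ?h|lebesgue. g x) + (LINT x:square a (b + ?h) ?h|lebesgue. g x)"
    by (rule split[where i="(0,1)" and c="b + ?h"]) (use assms(2) in \<open>auto simp: square_def Basis_prod_def\<close>)
  have 3: "(LINT x:?R|lebesgue. g x) = (LINT x:square (a+?h) b ?h|lebesgue. g x) + (LINT x:square (a+?h) (b + ?h) ?h|lebesgue. g x)"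
    by (rule split[where i="(0,1)" and c="b + ?h"]) (use assms(2) in \<open>auto simp: square_def Basis_prod_def\<close>)
  show ?thesis
    using assms(2) unfolding average_def 1 2 3 by (simp add: measure_square power2_eq_square field_simps)
qed

text \<open>The mean of a functional of squares over the \<open>4\<^sup>n\<close> dyadic descendants of generation
\<open>n\<close> of the square with lower left corner \<open>(a, b)\<close> and side \<open>s\<close>. Recursion on the
four children makes induction on \<open>n\<close> available without naming the descendants.\<close>

fun dyadic_mean :: "nat \<Rightarrow> ((real \<times> real) set \<Rightarrow> real) \<Rightarrow> real \<Rightarrow> real \<Rightarrow> real \<Rightarrow> real" where
  "dyadic_mean 0 \<Phi> a b s = \<Phi> (square a b s)"
| "dyadic_mean (Suc n) \<Phi> a b s =
    (dyadic_mean n \<Phi> a b (s/2) + dyadic_mean n \<Phi> (a + s/2) b (s/2)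
     + dyadic_mean n \<Phi> a (b + s/2) (s/2) + dyadic_mean n \<Phi> (a + s/2) (b + s/2) (s/2)) / 4"

text \<open>Only the lower left corners are recorded; the side of every child is \<open>s/2\<close>.\<close>

definition children :: "real \<Rightarrow> real \<Rightarrow> real \<Rightarrow> (real \<times> real) set" where
  "children a b s = {(a, b), (a + s/2, b), (a, b + s/2), (a + s/2, b + s/2)}"


lemma child_average_le:
  assumes "locally_integrable g" "\<And>x. 0 \<le> g x" "0 < s" "(a', b') \<in> children a b s"
  shows "average g (square a' b' (s/2)) \<le> 4 * average g (square a b s)"
proof -
  have nn: "0 \<le> average g Q" for Q by (rule average_nonneg) (rule assms)
  have "average g (square a' b' (s/2)) \<le> average g (square a b (s/2)) + average g (square (a + s/2) b (s/2))
     + average g (square a (b + s/2) (s/2)) + average g (square (a + s/2) (b + s/2) (s/2))"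
    using assms(4) nn[of "square a b (s/2)"] nn[of "square (a + s/2) b (s/2)"]
      nn[of "square a (b + s/2) (s/2)"] nn[of "square (a + s/2) (b + s/2) (s/2)"]
    unfolding children_def by auto
  then show ?thesis
    using average_children[OF set_integrable_square[OF assms(1)] assms(3), of a b] by simp
qed

lemma abs_average_square_minus_le:
  assumes "locally_integrable f" "0 < s"
  shows "\<bar>average f (square a b s) - c\<bar> \<le> average (\<lambda>x. \<bar>f x - c\<bar>) (square a b s)"
  using assms by (intro abs_average_minus_le set_integrable_square) (auto simp: measure_square_pos)

text \<open>A child has a quarter of the area of its parent, so the average over the child of
\<open>\<bar>f - f\<^sub>Q\<bar>\<close> is at most four times the mean oscillation on the parent \<open>Q\<close>. This bounds the
jumps of the dyadic averages of a function of bounded mean oscillation.\<close>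

lemma child_average_diff_le:
  assumes "locally_integrable f" "0 < s" "(a', b') \<in> children a b s"
  shows "\<bar>average f (square a' b' (s/2)) - average f (square a b s)\<bar> \<le> 4 * mean_osc f (square a b s)"
proof -
  let ?c = "average f (square a b s)"
  have "\<bar>average f (square a' b' (s/2)) - ?c\<bar> \<le> average (\<lambda>x. \<bar>f x - ?c\<bar>) (square a' b' (s/2))"
    using assms by (intro abs_average_square_minus_le) auto
  also have "\<dots> \<le> 4 * average (\<lambda>x. \<bar>f x - ?c\<bar>) (square a b s)"
    using assms by (intro child_average_le locally_integrable_abs_minus) auto
  finally show ?thesis by (simp add: mean_osc_eq_average)
qed

lemma dyadic_mean_mono:
  assumes "\<And>a b s. 0 < s \<Longrightarrow> \<Phi> (square a b s) \<le> \<Psi> (square a b s)" "0 < s"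
  shows "dyadic_mean n \<Phi> a b s \<le> dyadic_mean n \<Psi> a b s"
  using assms(2)
proof (induction n arbitrary: a b s)
  case (Suc n)
  then have "0 < s/2" by simp
  from Suc.IH[OF this] show ?case by (simp add: add_mono)
qed (simp add: assms(1))

lemma dyadic_mean_add:
  "dyadic_mean n (\<lambda>Q. \<Phi> Q + \<Psi> Q) a b s = dyadic_mean n \<Phi> a b s + dyadic_mean n \<Psi> a b s"
  by (induction n arbitrary: a b s) (simp_all add: field_simps)

lemma dyadic_mean_cmult: "dyadic_mean n (\<lambda>Q. c * \<Phi> Q) a b s = c * dyadic_mean n \<Phi> a b s"
  by (induction n arbitrary: a b s) (simp_all add: field_simps)

lemma dyadic_mean_average:
  assumes "locally_integrable g" "0 < s"
  shows "dyadic_mean n (average g) a b s = average g (square a b s)"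
  using assms(2)
proof (induction n arbitrary: a b s)
  case (Suc n)
  then have "0 < s/2" by simp
  from Suc.IH[OF this] show ?case
    using average_children[OF set_integrable_square[OF assms(1)] Suc.prems] by simp
qed simp

section \<open>The stopping-time argument on dyadic averages\<close>

text \<open>This is the stopping-time argument of John and Nirenberg, arranged as an induction on the
generation. The reference value \<open>c\<close> is passed to a child as long as the average over the child
stays within distance \<open>2\<close> of it. When it leaves, it does so by a jump of at most \<open>4\<close>, hence
to a distance of at most \<open>6\<close>, and replacing \<open>c\<close> by the average over the child costs a factor of at most
\<open>exp (6 \<mu>) \<le> 5/4\<close>; then the induction hypothesis together with oscillation at most \<open>1\<close>
bounds the contribution of this child by \<open>5/4 * (5/4 + 3) \<le> 6\<close>. A stopped child satisfies
\<open>average (\<lambda>x. \<bar>f x - c\<bar>) > 2\<close>, so this is paid for by the second term of the bound, and that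
term is additive over children. The coefficient \<open>3\<close> is chosen to make this last comparison
work.\<close>

lemma dyadic_exp_bound:
  assumes f: "locally_integrable f"
    and osc: "\<And>a b s. 0 < s \<Longrightarrow> mean_osc f (square a b s) \<le> 1"
    and \<mu>: "0 \<le> \<mu>" "exp (6 * \<mu>) \<le> 5/4"
    and "0 < s" "\<bar>average f (square a b s) - c\<bar> \<le> 2"
  shows "dyadic_mean n (\<lambda>Q. exp (\<mu> * \<bar>average f Q - c\<bar>)) a b s
    \<le> 5/4 + 3 * average (\<lambda>x. \<bar>f x - c\<bar>) (square a b s)"
  using assms(5,6)
proof (induction n arbitrary: a b s c)
  case 0
  have "\<mu> * \<bar>average f (square a b s) - c\<bar> \<le> \<mu> * 6"
    using 0 \<mu>(1) by (intro mult_left_mono) auto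
  then have "exp (\<mu> * \<bar>average f (square a b s) - c\<bar>) \<le> 5/4"
    using \<mu>(2) by (smt (verit) exp_le_cancel_iff mult.commute)
  moreover have "0 \<le> average (\<lambda>x. \<bar>f x - c\<bar>) (square a b s)"
    by (rule average_nonneg) simp
  ultimately show ?case by simp
next
  case (Suc n)
  let ?A = "\<lambda>a b. average (\<lambda>x. \<bar>f x - c\<bar>) (square a b (s/2))"
  let ?D = "dyadic_mean n (\<lambda>Q. exp (\<mu> * \<bar>average f Q - c\<bar>))"
  have child: "?D a' b' (s/2) \<le> 5/4 + 3 * ?A a' b'" if ab: "(a', b') \<in> children a b s" for a' b'
  proof (cases "\<bar>average f (square a' b' (s/2)) - c\<bar> \<le> 2")
    case True
    then show ?thesis using Suc.IH Suc.prems by simp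
  next
    case False
    let ?d = "average f (square a' b' (s/2))"
    have d: "\<bar>?d - c\<bar> \<le> 6"
      using child_average_diff_le[OF f Suc.prems(1) ab] osc[OF Suc.prems(1), of a b] Suc.prems(2) by linarith
    have "?D a' b' (s/2) \<le> dyadic_mean n (\<lambda>Q. exp (6*\<mu>) * exp (\<mu> * \<bar>average f Q - ?d\<bar>)) a' b' (s/2)"
    proof (rule dyadic_mean_mono)
      fix a b s
      have "\<bar>average f (square a b s) - c\<bar> \<le> 6 + \<bar>average f (square a b s) - ?d\<bar>"
        using d by linarith
      then have "\<mu> * \<bar>average f (square a b s) - c\<bar> \<le> \<mu> * (6 + \<bar>average f (square a b s) - ?d\<bar>)"
        using \<mu>(1) by (rule mult_left_mono)
      then show "exp (\<mu> * \<bar>average f (square a b s) - c\<bar>) \<le> exp (6*\<mu>) * exp (\<mu> * \<bar>average f (square a b s) - ?d\<bar>)"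
        unfolding exp_add[symmetric] by (simp add: algebra_simps)
    qed (use Suc.prems in simp)
    also have "\<dots> = exp (6*\<mu>) * dyadic_mean n (\<lambda>Q. exp (\<mu> * \<bar>average f Q - ?d\<bar>)) a' b' (s/2)"
      by (rule dyadic_mean_cmult)
    also have "\<dots> \<le> 5/4 * (5/4 + 3)"
    proof (rule mult_mono)
      have "dyadic_mean n (\<lambda>Q. exp (\<mu> * \<bar>average f Q - ?d\<bar>)) a' b' (s/2)
          \<le> 5/4 + 3 * average (\<lambda>x. \<bar>f x - ?d\<bar>) (square a' b' (s/2))"
        by (rule Suc.IH) (use Suc.prems in auto)
      then show "dyadic_mean n (\<lambda>Q. exp (\<mu> * \<bar>average f Q - ?d\<bar>)) a' b' (s/2) \<le> 5/4 + 3"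
        using osc[of "s/2" a' b'] Suc.prems(1) by (simp add: mean_osc_eq_average)
      have "dyadic_mean n (\<lambda>Q. 0 * 0) a' b' (s/2) \<le> dyadic_mean n (\<lambda>Q. exp (\<mu> * \<bar>average f Q - ?d\<bar>)) a' b' (s/2)"
        using Suc.prems(1) by (intro dyadic_mean_mono) auto
      then show "0 \<le> dyadic_mean n (\<lambda>Q. exp (\<mu> * \<bar>average f Q - ?d\<bar>)) a' b' (s/2)"
        unfolding dyadic_mean_cmult by simp
    qed (use \<mu> in auto)
    also have "\<dots> \<le> 3 * 2" by simp
    also have "\<dots> \<le> 3 * ?A a' b'"
      using abs_average_square_minus_le[OF f, of "s/2" a' b' c] False Suc.prems(1) by simp
    finally show ?thesis by simp
  qed
  have "average (\<lambda>x. \<bar>f x - c\<bar>) (square a b s)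
      = (?A a b + ?A (a + s/2) b + ?A a (b + s/2) + ?A (a + s/2) (b + s/2)) / 4"
    by (rule average_children[OF set_integrable_square[OF locally_integrable_abs_minus[OF f]] Suc.prems(1)])
  then show ?case
    using child[of a b] child[of "a + s/2" b] child[of a "b + s/2"] child[of "a + s/2" "b + s/2"]
    by (simp add: children_def)
qed

text \<open>This is the passage from dyadic averages of \<open>f\<close> back to \<open>f\<close> itself. On each descendant,
replacing \<open>f\<close> by its average under the Lipschitz function \<open>\<Psi>\<close> costs at most \<open>L\<close> times the
mean oscillation, and this error vanishes in the limit of late generations.\<close>

lemma average_lipschitz_le:
  assumes f: "locally_integrable f" and \<Psi>f: "locally_integrable (\<lambda>x. \<Psi> (f x))"
    and L: "\<And>u v. \<Psi> u \<le> \<Psi> v + L * \<bar>u - v\<bar>" and s: "0 < s"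
  shows "average (\<lambda>x. \<Psi> (f x)) (square a b s)
    \<le> dyadic_mean n (\<lambda>Q. \<Psi> (average f Q)) a b s + L * dyadic_mean n (mean_osc f) a b s"
proof -
  have one: "average (\<lambda>x. \<Psi> (f x)) (square a b s) \<le> \<Psi> (average f (square a b s)) + L * mean_osc f (square a b s)"
    if s: "0 < s" for a b s
  proof -
    let ?Q = "square a b s"
    let ?c = "average f ?Q"
    have i1: "set_integrable lebesgue ?Q (\<lambda>x. \<Psi> ?c)"
      by (rule set_integrable_const_lmeasurable) simp
    have i2: "set_integrable lebesgue ?Q (\<lambda>x. L * \<bar>f x - ?c\<bar>)"
      by (intro set_integrable_mult_right set_integrable_square locally_integrable_abs_minus f)
    have "average (\<lambda>x. \<Psi> (f x)) ?Q \<le> average (\<lambda>x. \<Psi> ?c + L * \<bar>f x - ?c\<bar>) ?Q"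
      by (rule average_mono[OF set_integrable_square[OF \<Psi>f] set_integral_add(1)[OF i1 i2]]) (rule L)
    also have "\<dots> = \<Psi> ?c + L * mean_osc f ?Q"
      unfolding average_add[OF i1 i2] average_cmult mean_osc_eq_average
      using s by (simp add: average_const measure_square_pos)
    finally show ?thesis .
  qed
  have "average (\<lambda>x. \<Psi> (f x)) (square a b s) = dyadic_mean n (average (\<lambda>x. \<Psi> (f x))) a b s"
    using dyadic_mean_average[OF \<Psi>f s] by simp
  also have "\<dots> \<le> dyadic_mean n (\<lambda>Q. \<Psi> (average f Q) + L * mean_osc f Q) a b s"
    by (rule dyadic_mean_mono) (use one s in auto)
  finally show ?thesis unfolding dyadic_mean_add dyadic_mean_cmult .
qed

section \<open>Dyadic mean oscillation tends to zero\<close>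

lemma mean_osc_perturb:
  assumes f: "locally_integrable f" and g: "locally_integrable g" and s: "0 < s"
  shows "mean_osc f (square a b s) \<le> 2 * average (\<lambda>x. \<bar>f x - g x\<bar>) (square a b s) + mean_osc g (square a b s)"
proof -
  let ?Q = "square a b s"
  let ?f = "average f ?Q" and ?g = "average g ?Q"
  have fi: "set_integrable lebesgue ?Q f" and gi: "set_integrable lebesgue ?Q g"
    using f g by (auto intro: set_integrable_square)
  have di: "set_integrable lebesgue ?Q (\<lambda>x. f x - g x)"
    by (rule set_integral_diff(1)[OF fi gi])
  have ci: "set_integrable lebesgue ?Q (\<lambda>x. c)" for c :: real
    by (rule set_integrable_const_lmeasurable) simp
  have dai: "set_integrable lebesgue ?Q (\<lambda>x. \<bar>f x - g x\<bar>)" by (rule set_integrable_abs[OF di])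
  have gai: "set_integrable lebesgue ?Q (\<lambda>x. \<bar>g x - ?g\<bar>)"
    by (intro set_integrable_square locally_integrable_abs_minus g)
  have "\<bar>?f - ?g\<bar> = \<bar>average (\<lambda>x. f x - g x) ?Q - 0\<bar>" by (simp add: average_diff[OF fi gi])
  also have "\<dots> \<le> average (\<lambda>x. \<bar>f x - g x\<bar>) ?Q"
    using abs_average_minus_le[OF _ _ di, of 0] s by (simp add: measure_square_pos)
  finally have fg: "\<bar>?f - ?g\<bar> \<le> average (\<lambda>x. \<bar>f x - g x\<bar>) ?Q" .
  have "mean_osc f ?Q \<le> average (\<lambda>x. (\<bar>f x - g x\<bar> + \<bar>g x - ?g\<bar>) + \<bar>?f - ?g\<bar>) ?Q"
    unfolding mean_osc_eq_average
    by (intro average_mono set_integral_add(1) dai gai ci set_integrable_square locally_integrable_abs_minus f) auto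
  also have "\<dots> = average (\<lambda>x. \<bar>f x - g x\<bar>) ?Q + mean_osc g ?Q + \<bar>?f - ?g\<bar>"
    unfolding average_add[OF set_integral_add(1)[OF dai gai] ci] average_add[OF dai gai] mean_osc_eq_average
    using s by (simp add: average_const measure_square_pos)
  finally show ?thesis using fg by simp
qed

lemma continuous_locally_integrable:
  fixes g :: "'a::euclidean_space \<Rightarrow> real"
  assumes "continuous_on UNIV g"
  shows "locally_integrable g"
  unfolding locally_integrable_def
proof (intro allI impI)
  fix K :: "'a set" assume K: "compact K"
  then obtain u where u: "K \<subseteq> cbox (- u) u"
    using compact_imp_bounded bounded_subset_cbox_symmetric by metis
  have "set_integrable lebesgue (cbox (- u) u) g"
    by (intro absolutely_integrable_continuous continuous_on_subset[OF assms]) auto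
  then show "set_integrable lebesgue K g"
    by (rule set_integrable_subset) (use K u in \<open>auto simp: lmeasurable_compact fmeasurableD\<close>)
qed

text \<open>The descendants of generation \<open>n\<close> have diameter at most \<open>2 * s / 2 ^ n\<close>. The set \<open>S\<close>
carrying the modulus of continuity stays fixed while the induction passes to the children.\<close>

lemma dyadic_mean_mean_osc_le_modulus:
  assumes g: "locally_integrable g" and s: "0 < s"
    and modulus: "\<And>x y. x \<in> S \<Longrightarrow> y \<in> S \<Longrightarrow> dist x y \<le> 2 * s / 2 ^ n \<Longrightarrow> \<bar>g x - g y\<bar> \<le> e"
    and sub: "square a b s \<subseteq> S"
  shows "dyadic_mean n (mean_osc g) a b s \<le> e"
  using s sub modulus
proof (induction n arbitrary: a b s)
  case 0
  let ?Q = "square a b s"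
  have near: "\<bar>g x - g y\<bar> \<le> e" if "x \<in> ?Q" "y \<in> ?Q" for x y
  proof (rule 0(3))
    obtain x1 x2 y1 y2 where xy: "x = (x1, x2)" "y = (y1, y2)" by (cases x, cases y)
    then have "\<bar>x1 - y1\<bar> \<le> s" "\<bar>x2 - y2\<bar> \<le> s"
      using that by (auto simp: square_def)
    moreover have "dist x y \<le> dist x1 y1 + dist x2 y2"
      unfolding xy dist_Pair_Pair by (rule sqrt_sum_squares_le_sum) auto
    ultimately show "dist x y \<le> 2 * s / 2 ^ 0"
      by (simp add: dist_real_def)
  qed (use that 0 in auto)
  have const: "set_integrable lebesgue ?Q (\<lambda>x. e)"
    by (rule set_integrable_const_lmeasurable) simp
  have avg_const: "average (\<lambda>x. e) ?Q = e"
    using 0 by (simp add: average_const measure_square_pos)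
  have "\<bar>g x - average g ?Q\<bar> \<le> e" if x: "x \<in> ?Q" for x
  proof -
    have "\<bar>average g ?Q - g x\<bar> \<le> average (\<lambda>y. \<bar>g y - g x\<bar>) ?Q"
      by (rule abs_average_square_minus_le[OF g 0(1)])
    also have "\<dots> \<le> average (\<lambda>x. e) ?Q"
      by (rule average_mono[OF set_integrable_square[OF locally_integrable_abs_minus[OF g]] const])
        (rule near[OF _ x])
    finally show ?thesis unfolding avg_const by linarith
  qed
  then have "average (\<lambda>x. \<bar>g x - average g ?Q\<bar>) ?Q \<le> average (\<lambda>x. e) ?Q"
    by (rule average_mono[OF set_integrable_square[OF locally_integrable_abs_minus[OF g]] const])
  then show ?case unfolding avg_const by (simp add: mean_osc_eq_average)
next
  case (Suc n)
  have "dyadic_mean n (mean_osc g) a' b' (s/2) \<le> e" if "(a', b') \<in> children a b s" for a' b'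
  proof (rule Suc.IH)
    have "square a' b' (s/2) \<subseteq> square a b s"
      using that Suc.prems(1) by (auto simp: children_def square_def field_simps)
    then show "square a' b' (s/2) \<subseteq> S" using Suc.prems(2) by simp
    show "\<bar>g x - g y\<bar> \<le> e" if "x \<in> S" "y \<in> S" "dist x y \<le> 2 * (s/2) / 2 ^ n" for x y
      using Suc.prems(3)[of x y] that by (simp add: field_simps)
  qed (use Suc.prems in auto)
  from this[of a b] this[of "a + s/2" b] this[of a "b + s/2"] this[of "a + s/2" "b + s/2"]
  show ?case by (simp add: children_def)
qed

text \<open>A measurable function is an almost everywhere limit of continuous functions. Truncation at a
high level \<open>B\<close> changes \<open>f\<close> little in \<open>L\<^sup>1\<close> and makes dominated convergence
applicable to the truncated continuous functions.\<close>

lemma continuous_approx_L1: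
  fixes f :: "'a::euclidean_space \<Rightarrow> real"
  assumes S: "S \<in> lmeasurable" and f: "set_integrable lebesgue S f" and "0 < e"
  shows "\<exists>g. continuous_on UNIV g \<and> (LINT x:S|lebesgue. \<bar>f x - g x\<bar>) < e"
proof -
  define F where "F = (\<lambda>x. indicator S x * f x)"
  define clamp where "clamp = (\<lambda>(B::real) t. max (- B) (min B t))"
  have F: "integrable lebesgue F" using f by (simp add: F_def set_integrable_def)
  have Fm[measurable]: "F \<in> borel_measurable lebesgue" using F by simp
  have Sm[measurable]: "S \<in> sets lebesgue" using S by auto
  obtain N g where N: "negligible N" and gc: "\<And>n::nat. continuous_on UNIV (g n)"
    and gF: "\<And>x. x \<notin> N \<Longrightarrow> (\<lambda>n. g n x) \<longlonglongrightarrow> F x"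
    using lebesgue_measurable_imp_measurable_on[of F UNIV] by (auto simp: measurable_on_def)
  have gm[measurable]: "g n \<in> borel_measurable lebesgue" for n
    using gc by (intro measurable_completion) (simp add: borel_measurable_continuous_onI)
  have "(\<lambda>B. LINT x|lebesgue. \<bar>F x - clamp (real B) (F x)\<bar>) \<longlonglongrightarrow> (LINT x|(lebesgue::'a measure). 0)"
  proof (rule integral_dominated_convergence[where w="\<lambda>x. \<bar>F x\<bar>"])
    show "AE x in lebesgue. (\<lambda>B. \<bar>F x - clamp (real B) (F x)\<bar>) \<longlonglongrightarrow> 0"
    proof (rule AE_I2)
      fix x
      obtain B0 :: nat where B0: "\<bar>F x\<bar> \<le> real B0" using real_arch_simple by blast
      have "\<forall>\<^sub>F B in sequentially. \<bar>F x - clamp (real B) (F x)\<bar> = 0"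
        unfolding eventually_sequentially
        by (intro exI[of _ B0]) (use B0 in \<open>auto simp: clamp_def\<close>)
      then show "(\<lambda>B. \<bar>F x - clamp (real B) (F x)\<bar>) \<longlonglongrightarrow> 0" by (rule tendsto_eventually)
    qed
    show "AE x in lebesgue. norm \<bar>F x - clamp (real B) (F x)\<bar> \<le> \<bar>F x\<bar>" for B
      by (rule AE_I2) (auto simp: clamp_def)
  qed (use F in \<open>auto simp: clamp_def\<close>)
  then have "\<forall>\<^sub>F B in sequentially. (LINT x|lebesgue. \<bar>F x - clamp (real B) (F x)\<bar>) < e/2"
    by (rule order_tendstoD(2)) (use \<open>0 < e\<close> in auto)
  then obtain B :: nat where B: "(LINT x|lebesgue. \<bar>F x - clamp (real B) (F x)\<bar>) < e/2"
    by (auto simp: eventually_sequentially)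
  have dom: "integrable lebesgue (\<lambda>x. 2 * real B * indicator S x)"
    using S by (auto simp: fmeasurable_def)
  have ind: "\<bar>clamp (real B) u - clamp (real B) v\<bar> \<le> 2 * real B" for u v
    by (auto simp: clamp_def)
  have "(\<lambda>n. LINT x|lebesgue. indicator S x * \<bar>clamp (real B) (F x) - clamp (real B) (g n x)\<bar>)
      \<longlonglongrightarrow> (LINT x|(lebesgue::'a measure). 0)"
  proof (rule integral_dominated_convergence[where w="\<lambda>x. 2 * real B * indicator S x"])
    have "AE x in lebesgue. x \<notin> N"
      using N by (intro AE_not_in) (simp add: negligible_iff_null_sets)
    then show "AE x in lebesgue. (\<lambda>n. indicator S x * \<bar>clamp (real B) (F x) - clamp (real B) (g n x)\<bar>) \<longlonglongrightarrow> 0"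
    proof eventually_elim
      fix x assume "x \<notin> N"
      then have "(\<lambda>n. indicator S x * \<bar>clamp (real B) (F x) - clamp (real B) (g n x)\<bar>)
          \<longlonglongrightarrow> indicator S x * \<bar>clamp (real B) (F x) - clamp (real B) (F x)\<bar>"
        unfolding clamp_def by (intro tendsto_intros gF)
      then show "(\<lambda>n. indicator S x * \<bar>clamp (real B) (F x) - clamp (real B) (g n x)\<bar>) \<longlonglongrightarrow> 0" by simp
    qed
    show "AE x in lebesgue. norm (indicator S x * \<bar>clamp (real B) (F x) - clamp (real B) (g n x)\<bar>)
        \<le> 2 * real B * indicator S x" for n
      by (rule AE_I2) (use ind in \<open>auto split: split_indicator\<close>)
    show "(\<lambda>x. indicator S x * \<bar>clamp (real B) (F x) - clamp (real B) (g n x)\<bar>) \<in> borel_measurable lebesgue" for n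
      unfolding clamp_def by measurable
  qed (use dom in auto)
  then have "\<forall>\<^sub>F n in sequentially. (LINT x|lebesgue. indicator S x * \<bar>clamp (real B) (F x) - clamp (real B) (g n x)\<bar>) < e/2"
    by (rule order_tendstoD(2)) (use \<open>0 < e\<close> in auto)
  then obtain n where n: "(LINT x|lebesgue. indicator S x * \<bar>clamp (real B) (F x) - clamp (real B) (g n x)\<bar>) < e/2"
    by (auto simp: eventually_sequentially)
  have i1: "integrable lebesgue (\<lambda>x. \<bar>F x - clamp (real B) (F x)\<bar>)"
    by (rule Bochner_Integration.integrable_bound[OF F]) (auto simp: clamp_def)
  have i2: "integrable lebesgue (\<lambda>x. indicator S x * \<bar>clamp (real B) (F x) - clamp (real B) (g n x)\<bar>)"
  proof (rule Bochner_Integration.integrable_bound[OF dom])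
    show "(\<lambda>x. indicator S x * \<bar>clamp (real B) (F x) - clamp (real B) (g n x)\<bar>) \<in> borel_measurable lebesgue"
      unfolding clamp_def by measurable
    show "AE x in lebesgue. norm (indicator S x * \<bar>clamp (real B) (F x) - clamp (real B) (g n x)\<bar>)
        \<le> norm (2 * real B * indicator S x)"
      by (rule AE_I2) (use ind in \<open>auto split: split_indicator\<close>)
  qed
  have "(LINT x:S|lebesgue. \<bar>f x - clamp (real B) (g n x)\<bar>)
      \<le> (LINT x|lebesgue. \<bar>F x - clamp (real B) (F x)\<bar>
          + indicator S x * \<bar>clamp (real B) (F x) - clamp (real B) (g n x)\<bar>)"
    unfolding set_lebesgue_integral_def
  proof (rule integral_mono')
    show "integrable lebesgue (\<lambda>x. \<bar>F x - clamp (real B) (F x)\<bar>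
          + indicator S x * \<bar>clamp (real B) (F x) - clamp (real B) (g n x)\<bar>)"
      by (rule Bochner_Integration.integrable_add[OF i1 i2])
  qed (auto simp: F_def split: split_indicator)
  also have "\<dots> < e"
    using B n by (simp add: Bochner_Integration.integral_add[OF i1 i2])
  finally have "(LINT x:S|lebesgue. \<bar>f x - clamp (real B) (g n x)\<bar>) < e" .
  moreover have "continuous_on UNIV (\<lambda>x. clamp (real B) (g n x))"
    unfolding clamp_def by (intro continuous_intros gc)
  ultimately show ?thesis by blast
qed

text \<open>For a continuous function this is uniform continuity on the square. The general case
follows by approximation in \<open>L\<^sup>1\<close>, because the dyadic mean of an average is again the
average over the large square, so that the error does not depend on the generation.\<close>

lemma dyadic_mean_mean_osc_small:
  assumes f: "locally_integrable f" and s: "0 < s" and e: "0 < e"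
  shows "\<exists>n. dyadic_mean n (mean_osc f) a b s \<le> e"
proof -
  let ?Q = "square a b s"
  obtain g where gc: "continuous_on UNIV g" and fg: "(LINT x:?Q|lebesgue. \<bar>f x - g x\<bar>) < e/4 * s\<^sup>2"
    using continuous_approx_L1[of ?Q f "e/4 * s\<^sup>2"] set_integrable_square[OF f] s e by auto
  have g: "locally_integrable g" by (rule continuous_locally_integrable[OF gc])
  have avg: "average (\<lambda>x. \<bar>f x - g x\<bar>) ?Q \<le> e/4"
    using fg s unfolding average_def by (simp add: measure_square field_simps)
  have fgi: "locally_integrable (\<lambda>x. \<bar>f x - g x\<bar>)"
    using f g unfolding locally_integrable_def by (auto intro!: set_integrable_abs)
  have "uniformly_continuous_on ?Q g"
    using gc by (intro compact_uniformly_continuous continuous_on_subset[OF gc]) (auto simp: square_eq_cbox)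
  then obtain d where d: "0 < d" "\<And>x y. x \<in> ?Q \<Longrightarrow> y \<in> ?Q \<Longrightarrow> dist y x < d \<Longrightarrow> dist (g y) (g x) < e/2"
    using e unfolding uniformly_continuous_on_def by (metis half_gt_zero)
  obtain n where n: "2 * s / d < 2 ^ n" using real_arch_pow[of 2 "2 * s / d"] by auto
  then have n': "2 * s / 2 ^ n < d" using d(1) by (simp add: field_simps)
  have osc_g: "dyadic_mean n (mean_osc g) a b s \<le> e/2"
  proof (rule dyadic_mean_mean_osc_le_modulus[OF g s])
    show "\<bar>g x - g y\<bar> \<le> e/2" if "x \<in> ?Q" "y \<in> ?Q" "dist x y \<le> 2 * s / 2 ^ n" for x y
      using d(2)[OF that(2,1)] that(3) n' by (simp add: dist_real_def)
  qed simp
  have "dyadic_mean n (mean_osc f) a b s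
      \<le> dyadic_mean n (\<lambda>Q. 2 * average (\<lambda>x. \<bar>f x - g x\<bar>) Q + mean_osc g Q) a b s"
    by (rule dyadic_mean_mono) (use mean_osc_perturb[OF f g] s in auto)
  also have "\<dots> = 2 * average (\<lambda>x. \<bar>f x - g x\<bar>) ?Q + dyadic_mean n (mean_osc g) a b s"
    unfolding dyadic_mean_add dyadic_mean_cmult by (simp add: dyadic_mean_average[OF fgi s])
  also have "\<dots> \<le> e" using avg osc_g by simp
  finally show ?thesis by blast
qed

section \<open>The John--Nirenberg inequality on squares\<close>

lemma locally_integrable_borel_measurable:
  assumes "locally_integrable f"
  shows "f \<in> borel_measurable lebesgue"
proof (rule borel_measurable_LIMSEQ_real)
  show "(\<lambda>x. indicator (cball 0 (real n)) x *\<^sub>R f x) \<in> borel_measurable lebesgue" for n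
    using assms unfolding locally_integrable_def set_integrable_def
    by (intro borel_measurable_integrable) auto
  fix x :: 'a
  obtain N :: nat where N: "norm x \<le> real N" using real_arch_simple by blast
  have "\<forall>\<^sub>F n in sequentially. indicator (cball 0 (real n)) x *\<^sub>R f x = f x"
    unfolding eventually_sequentially by (intro exI[of _ N]) (use N in \<open>auto simp: indicator_def\<close>)
  then show "(\<lambda>n. indicator (cball 0 (real n)) x *\<^sub>R f x) \<longlonglongrightarrow> f x"
    by (rule tendsto_eventually)
qed

text \<open>Truncating the exponent rather than the exponential gives an explicit Lipschitz
constant.\<close>

lemma exp_min_lipschitz:
  fixes \<mu> K c u v :: real
  assumes "0 \<le> \<mu>"
  shows "exp (min (\<mu> * \<bar>u - c\<bar>) K) \<le> exp (min (\<mu> * \<bar>v - c\<bar>) K) + exp K * \<mu> * \<bar>u - v\<bar>"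
proof -
  define p where "p = min (\<mu> * \<bar>u - c\<bar>) K"
  define q where "q = min (\<mu> * \<bar>v - c\<bar>) K"
  have "\<mu> * \<bar>u - c\<bar> \<le> \<mu> * (\<bar>v - c\<bar> + \<bar>u - v\<bar>)"
    using assms by (intro mult_left_mono) auto
  moreover have nn: "0 \<le> \<mu> * \<bar>u - v\<bar>" using assms by simp
  ultimately have pq: "p - q \<le> \<mu> * \<bar>u - v\<bar>"
    unfolding p_def q_def by (auto simp: algebra_simps min_def)
  have "exp p \<le> exp q + exp K * (\<mu> * \<bar>u - v\<bar>)"
  proof (cases "p \<le> q")
    case True
    then have "exp p \<le> exp q" by simp
    then show ?thesis using nn by (smt (verit) exp_gt_zero mult_nonneg_nonneg)
  next
    case False
    have "exp p * (1 + (q - p)) \<le> exp p * exp (q - p)"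
      using exp_ge_add_one_self[of "q - p"] by (intro mult_left_mono) auto
    also have "\<dots> = exp q" by (simp add: exp_diff)
    finally have "exp p - exp q \<le> exp p * (p - q)" by (simp add: algebra_simps)
    also have "\<dots> \<le> exp K * (\<mu> * \<bar>u - v\<bar>)"
      using pq False by (intro mult_mono) (auto simp: p_def)
    finally show ?thesis by simp
  qed
  then show ?thesis by (simp add: p_def q_def mult.assoc)
qed

text \<open>For the exponential with exponent truncated at \<open>k\<close>, the dyadic bound carries over to
\<open>f\<close> up to an error proportional to the dyadic mean oscillation, which can be made arbitrarily
small by going to late generations. The resulting constant \<open>5/4 + 3 = 17/4\<close> does not depend on
\<open>k\<close>, so monotone convergence removes the truncation.\<close>

theorem john_nirenberg_square:
  assumes f: "locally_integrable f"
    and osc: "\<And>a b s. 0 < s \<Longrightarrow> mean_osc f (square a b s) \<le> 1"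
    and \<mu>: "0 \<le> \<mu>" "exp (6 * \<mu>) \<le> 5/4" and s: "0 < s"
  shows "(\<integral>\<^sup>+x\<in>square a b s. ennreal (exp (\<mu> * \<bar>f x - average f (square a b s)\<bar>)) \<partial>lebesgue)
    \<le> ennreal (5 * s\<^sup>2)"
proof -
  let ?Q = "square a b s"
  define c where "c = average f ?Q"
  define \<Psi> where "\<Psi> = (\<lambda>k::nat. \<lambda>t. exp (min (\<mu> * \<bar>t - c\<bar>) (real k)))"
  have [measurable]: "f \<in> borel_measurable lebesgue"
    by (rule locally_integrable_borel_measurable[OF f])
  have \<Psi>m[measurable]: "(\<lambda>x. \<Psi> k (f x)) \<in> borel_measurable lebesgue" for k
    unfolding \<Psi>_def by measurable
  have \<Psi>i: "locally_integrable (\<lambda>x. \<Psi> k (f x))" for k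
    unfolding locally_integrable_def
  proof (intro allI impI)
    fix K :: "(real \<times> real) set" assume "compact K"
    then have K: "K \<in> lmeasurable" by (rule lmeasurable_compact)
    have [measurable]: "K \<in> sets lebesgue" using K by auto
    show "set_integrable lebesgue K (\<lambda>x. \<Psi> k (f x))"
      by (rule set_integrable_bound[OF set_integrable_const_lmeasurable[OF K, of "exp (real k)"]])
        (auto simp: set_borel_measurable_def \<Psi>_def)
  qed
  have avg: "average (\<lambda>x. \<Psi> k (f x)) ?Q \<le> 17/4" for k
  proof (rule field_le_epsilon)
    fix e :: real assume e: "0 < e"
    let ?L = "exp (real k) * \<mu>"
    have L: "0 \<le> ?L" using \<mu> by simp
    obtain n where n: "dyadic_mean n (mean_osc f) a b s \<le> e / (?L + 1)"
      using dyadic_mean_mean_osc_small[OF f s, of "e / (?L + 1)"] e L by auto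
    have "?L * dyadic_mean n (mean_osc f) a b s \<le> ?L * (e / (?L + 1))"
      using n L by (rule mult_left_mono)
    also have "\<dots> \<le> e" using L e by (simp add: field_simps add_pos_nonneg)
    finally have small: "?L * dyadic_mean n (mean_osc f) a b s \<le> e" .
    have "dyadic_mean n (\<lambda>Q. \<Psi> k (average f Q)) a b s
        \<le> dyadic_mean n (\<lambda>Q. exp (\<mu> * \<bar>average f Q - c\<bar>)) a b s"
      by (rule dyadic_mean_mono) (use s in \<open>auto simp: \<Psi>_def\<close>)
    also have "\<dots> \<le> 5/4 + 3 * average (\<lambda>x. \<bar>f x - c\<bar>) ?Q"
      by (rule dyadic_exp_bound[OF f osc \<mu> s]) (auto simp: c_def)
    also have "\<dots> \<le> 17/4"
      using osc[OF s, of a b] by (simp add: mean_osc_eq_average c_def)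
    finally have "dyadic_mean n (\<lambda>Q. \<Psi> k (average f Q)) a b s \<le> 17/4" .
    moreover have "average (\<lambda>x. \<Psi> k (f x)) ?Q
        \<le> dyadic_mean n (\<lambda>Q. \<Psi> k (average f Q)) a b s + ?L * dyadic_mean n (mean_osc f) a b s"
      by (rule average_lipschitz_le[OF f \<Psi>i _ s]) (unfold \<Psi>_def, rule exp_min_lipschitz[OF \<mu>(1)])
    ultimately show "average (\<lambda>x. \<Psi> k (f x)) ?Q \<le> 17/4 + e" using small by simp
  qed
  have bound: "(\<integral>\<^sup>+x. ennreal (\<Psi> k (f x)) * indicator ?Q x \<partial>lebesgue) \<le> ennreal (5 * s\<^sup>2)" for k
  proof -
    have "(\<integral>\<^sup>+x. ennreal (\<Psi> k (f x)) * indicator ?Q x \<partial>lebesgue)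
        = (\<integral>\<^sup>+x. ennreal (indicator ?Q x *\<^sub>R \<Psi> k (f x)) \<partial>lebesgue)"
      by (intro nn_integral_cong) (auto split: split_indicator)
    also have "\<dots> = ennreal (LINT x:?Q|lebesgue. \<Psi> k (f x))"
      unfolding set_lebesgue_integral_def
      by (rule nn_integral_eq_integral)
        (use set_integrable_square[OF \<Psi>i, of a b s k] in \<open>auto simp: set_integrable_def \<Psi>_def\<close>)
    also have "(LINT x:?Q|lebesgue. \<Psi> k (f x)) = s\<^sup>2 * average (\<lambda>x. \<Psi> k (f x)) ?Q"
      using s by (simp add: average_def measure_square)
    also have "ennreal \<dots> \<le> ennreal (5 * s\<^sup>2)"
      using avg[of k] s by (intro ennreal_leI) (simp add: mult.commute)
    finally show ?thesis .
  qed
  have "(\<integral>\<^sup>+x. ennreal (exp (\<mu> * \<bar>f x - c\<bar>)) * indicator ?Q x \<partial>lebesgue)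
      \<le> (\<integral>\<^sup>+x. (SUP k. ennreal (\<Psi> k (f x)) * indicator ?Q x) \<partial>lebesgue)"
  proof (rule nn_integral_mono)
    fix x
    obtain k :: nat where "\<mu> * \<bar>f x - c\<bar> \<le> real k" using real_arch_simple by blast
    then have "ennreal (exp (\<mu> * \<bar>f x - c\<bar>)) * indicator ?Q x = ennreal (\<Psi> k (f x)) * indicator ?Q x"
      by (simp add: \<Psi>_def min_def)
    then show "ennreal (exp (\<mu> * \<bar>f x - c\<bar>)) * indicator ?Q x \<le> (SUP k. ennreal (\<Psi> k (f x)) * indicator ?Q x)"
      by (metis SUP_upper UNIV_I)
  qed
  also have "\<dots> = (SUP k. \<integral>\<^sup>+x. ennreal (\<Psi> k (f x)) * indicator ?Q x \<partial>lebesgue)"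
  proof (rule nn_integral_monotone_convergence_SUP)
    show "incseq (\<lambda>k x. ennreal (\<Psi> k (f x)) * indicator ?Q x)"
      by (auto simp: incseq_def le_fun_def \<Psi>_def intro!: mult_right_mono ennreal_leI)
  qed measurable
  also have "\<dots> \<le> ennreal (5 * s\<^sup>2)"
    by (rule SUP_least) (rule bound)
  finally show ?thesis unfolding c_def .
qed

section \<open>Slices\<close>

text \<open>The mean oscillation is at most twice the average \<open>m\<close> of \<open>\<bar>h - c\<bar>\<close>, which explains the
factor \<open>1/2\<close>. The rest is Jensen's inequality, obtained by integrating the tangent line of
\<open>t \<mapsto> exp (\<mu> * t)\<close> at \<open>m\<close>.\<close>

lemma exp_mean_osc_le:
  fixes h :: "'a::euclidean_space \<Rightarrow> real"
  assumes [measurable]: "h \<in> borel_measurable lebesgue" and S: "S \<in> lmeasurable" "0 < measure lebesgue S"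
    and \<mu>: "0 < \<mu>"
  shows "ennreal (measure lebesgue S * exp (\<mu> / 2 * mean_osc h S))
    \<le> (\<integral>\<^sup>+x\<in>S. ennreal (exp (\<mu> * \<bar>h x - c\<bar>)) \<partial>lebesgue)"
proof (cases "(\<integral>\<^sup>+x\<in>S. ennreal (exp (\<mu> * \<bar>h x - c\<bar>)) \<partial>lebesgue) = \<infinity>")
  case False
  have [measurable]: "S \<in> sets lebesgue" using S by auto
  let ?E = "\<lambda>x. exp (\<mu> * \<bar>h x - c\<bar>)"
  have const: "set_integrable lebesgue S (\<lambda>x. t)" for t :: real
    by (rule set_integrable_const_lmeasurable[OF S(1)])
  have nn: "(\<integral>\<^sup>+x\<in>S. ennreal (?E x) \<partial>lebesgue) = (\<integral>\<^sup>+x. ennreal (indicator S x *\<^sub>R ?E x) \<partial>lebesgue)"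
    by (intro nn_integral_cong) (auto split: split_indicator)
  have E: "set_integrable lebesgue S ?E"
    unfolding set_integrable_def
    by (rule integrableI_nonneg) (use False nn in \<open>auto simp: less_top\<close>)
  have abs: "set_integrable lebesgue S (\<lambda>x. \<bar>h x - c\<bar>)"
  proof (rule set_integrable_bound)
    show "set_integrable lebesgue S (\<lambda>x. ?E x / \<mu>)" using E by (rule set_integrable_divide)
    show "AE x in lebesgue. x \<in> S \<longrightarrow> norm \<bar>h x - c\<bar> \<le> norm (?E x / \<mu>)"
    proof (intro AE_I2 impI)
      fix x
      have "\<mu> * \<bar>h x - c\<bar> \<le> ?E x" using exp_ge_add_one_self[of "\<mu> * \<bar>h x - c\<bar>"] by linarith
      then show "norm \<bar>h x - c\<bar> \<le> norm (?E x / \<mu>)" using \<mu> by (simp add: field_simps)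
    qed
  qed (simp add: set_borel_measurable_def)
  have "set_integrable lebesgue S (\<lambda>x. h x - c)"
    using abs by (subst (asm) set_integrable_abs_iff') auto
  from set_integral_add(1)[OF this const[of c]] have h: "set_integrable lebesgue S h" by simp
  define m where "m = average (\<lambda>x. \<bar>h x - c\<bar>) S"
  have hm: "\<bar>average h S - c\<bar> \<le> m"
    unfolding m_def by (rule abs_average_minus_le[OF S h])
  have "mean_osc h S \<le> average (\<lambda>x. \<bar>h x - c\<bar> + m) S"
    unfolding mean_osc_eq_average
    by (intro average_mono set_integrable_abs set_integral_diff(1) set_integral_add(1) abs const h)
      (use hm in auto)
  also have "\<dots> = 2 * m"
    using S by (simp add: average_add[OF abs const] average_const m_def)
  finally have osc: "mean_osc h S \<le> 2 * m" .
  have aff: "set_integrable lebesgue S (\<lambda>x. exp (\<mu> * m) * \<mu> * \<bar>h x - c\<bar> + exp (\<mu> * m) * (1 - \<mu> * m))"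
    by (intro set_integral_add(1) set_integrable_mult_right abs const)
  have "\<mu> / 2 * mean_osc h S \<le> \<mu> / 2 * (2 * m)"
    using osc \<mu> by (intro mult_left_mono) auto
  then have "exp (\<mu> / 2 * mean_osc h S) \<le> exp (\<mu> * m)" by simp
  also have "exp (\<mu> * m) = average (\<lambda>x. exp (\<mu> * m) * \<mu> * \<bar>h x - c\<bar> + exp (\<mu> * m) * (1 - \<mu> * m)) S"
    unfolding average_add[OF set_integrable_mult_right[OF abs] const] average_cmult average_const[OF S]
      m_def[symmetric] by (simp add: algebra_simps)
  also have "\<dots> \<le> average ?E S"
  proof (rule average_mono[OF aff E])
    fix x
    have "exp (\<mu> * m) * (1 + (\<mu> * \<bar>h x - c\<bar> - \<mu> * m)) \<le> exp (\<mu> * m) * exp (\<mu> * \<bar>h x - c\<bar> - \<mu> * m)"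
      using exp_ge_add_one_self by (intro mult_left_mono) auto
    then show "exp (\<mu> * m) * \<mu> * \<bar>h x - c\<bar> + exp (\<mu> * m) * (1 - \<mu> * m) \<le> ?E x"
      by (simp add: exp_diff algebra_simps)
  qed
  finally have "measure lebesgue S * exp (\<mu> / 2 * mean_osc h S) \<le> (LINT x:S|lebesgue. ?E x)"
    using S unfolding average_def by (simp add: field_simps)
  then have "ennreal (measure lebesgue S * exp (\<mu> / 2 * mean_osc h S)) \<le> ennreal (LINT x:S|lebesgue. ?E x)"
    by (rule ennreal_leI)
  also have "\<dots> = (\<integral>\<^sup>+x\<in>S. ennreal (?E x) \<partial>lebesgue)"
    unfolding nn set_lebesgue_integral_def
    by (rule nn_integral_eq_integral[symmetric]) (use E in \<open>auto simp: set_integrable_def\<close>)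
  finally show ?thesis .
qed simp

text \<open>Dividing the exponent by \<open>k\<close> gains a factor that is geometrically small in \<open>k\<close>: if
\<open>w = exp (v / k)\<close> exceeds \<open>4\<close>, then \<open>w / 4 \<le> (w / 4) ^ k\<close>. The base \<open>4\<close> is chosen so
that the series over \<open>k\<close> still converges against integrals of size \<open>2 ^ k\<close>.\<close>

lemma exp_divide_le:
  fixes v :: real and k :: nat
  assumes "1 \<le> k"
  shows "exp (v / k) \<le> 4 + 4 * (1/4) ^ k * exp v"
proof (cases "exp (v / k) \<le> 4")
  case True
  then show ?thesis by (smt (verit) exp_gt_zero mult_nonneg_nonneg zero_le_power divide_nonneg_nonneg)
next
  case False
  have "exp (v / k) / 4 \<le> (exp (v / k) / 4) ^ k"
    using False assms by (intro self_le_power) auto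
  also have "\<dots> = (1/4) ^ k * exp v"
    using assms by (simp add: power_divide exp_of_nat_mult[symmetric])
  finally show ?thesis by simp
qed

lemma exp_ext_SUP_le:
  fixes u :: "nat \<Rightarrow> real"
  assumes "0 < lam" and le: "\<And>k. 1 \<le> k \<Longrightarrow> ennreal (exp (lam * u k)) \<le> C"
  shows "exp_ext (ereal lam * (SUP k\<in>{1..}. ereal (u k))) \<le> C"
proof (cases C)
  case (real r)
  have r: "exp (lam * u k) \<le> r" if "1 \<le> k" for k
    using le[OF that] real by (simp add: ennreal_le_iff)
  have rpos: "0 < r" using r[of 1] exp_gt_zero[of "lam * u 1"] by linarith
  have "u k \<le> ln r / lam" if "1 \<le> k" for k
    using r[OF that] rpos assms(1) by (simp add: field_simps ln_ge_iff)
  then have up: "(SUP k\<in>{1..}. ereal (u k)) \<le> ereal (ln r / lam)"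
    by (intro SUP_least) auto
  moreover have "ereal (u 1) \<le> (SUP k\<in>{1..}. ereal (u k))"
    by (rule SUP_upper) auto
  ultimately obtain t where t: "(SUP k\<in>{1..}. ereal (u k)) = ereal t"
    by (cases "SUP k\<in>{1..}. ereal (u k)") auto
  then have "lam * t \<le> ln r" using up assms(1) by (simp add: field_simps)
  then have "exp (lam * t) \<le> r" using rpos by (simp add: ln_ge_iff)
  then show ?thesis unfolding t real by (simp add: exp_ext_def ennreal_leI)
qed simp

text \<open>A set that is not measurable, or has infinite measure, has \<^const>\<open>measure\<close> equal to
\<open>0\<close>.\<close>

lemma interval_of_length_lmeasurable:
  assumes "interval_of_length l S" "0 < l"
  shows "S \<in> lmeasurable"
proof -
  have m: "0 < measure lebesgue S" using assms by (simp add: interval_of_length_def)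
  then have "S \<in> sets lebesgue" using measure_notin_sets by fastforce
  moreover have "emeasure lebesgue S \<noteq> \<infinity>"
    using m by (auto simp: measure_def)
  ultimately show ?thesis by (auto simp: fmeasurable_def less_top)
qed

lemma interval_of_length_subset_Icc:
  assumes S: "interval_of_length l S" and l: "0 < l"
  obtains a where "S \<subseteq> {a..a + l}"
proof -
  have lm: "S \<in> lmeasurable" by (rule interval_of_length_lmeasurable[OF assms])
  have diff: "y - x \<le> l" if "x \<in> S" "y \<in> S" for x y
  proof (cases "x \<le> y")
    case True
    have "{x..y} \<subseteq> S"
      using S that unfolding interval_of_length_def by (meson atLeastAtMost_iff mem_is_interval_1_I subsetI)
    then have "measure lebesgue {x..y} \<le> measure lebesgue S"
      using lm by (intro measure_mono_fmeasurable) auto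
    then show ?thesis using S True by (simp add: interval_of_length_def)
  qed (use l in simp)
  have "S \<subseteq> {Inf S..Inf S + l}"
  proof
    fix x assume x: "x \<in> S"
    have "bdd_below S" using diff[OF _ x] by (intro bdd_belowI[of _ "x - l"]) force
    then have "Inf S \<le> x" by (rule cInf_lower[OF x])
    moreover have "x - l \<le> Inf S"
      using x diff[OF _ x] by (intro cInf_greatest) force+
    ultimately show "x \<in> {Inf S..Inf S + l}" by simp
  qed
  then show ?thesis using that by blast
qed

lemma lebesgue_measurable_cong_AE:
  fixes f g :: "'a::euclidean_space \<Rightarrow> real"
  assumes g: "g \<in> borel_measurable lebesgue" and eq: "AE x in lebesgue. f x = g x"
  shows "f \<in> borel_measurable lebesgue"
proof (rule measurableI)
  fix A :: "real set" assume A: "A \<in> sets borel"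
  have meas: "g -` A \<inter> space lebesgue \<in> sets lebesgue"
    using g A by (rule measurable_sets)
  have "AE x in lebesgue. x \<in> g -` A \<inter> space lebesgue \<longleftrightarrow> x \<in> f -` A \<inter> space lebesgue"
    using eq by eventually_elim auto
  then show "f -` A \<inter> space lebesgue \<in> sets lebesgue"
    by (rule completion.in_sets_AE[OF _ meas]) auto
qed simp

text \<open>Slices of a Lebesgue measurable function are measurable only for almost every \<open>y\<close>, and
the Lebesgue measure of the plane is not a product measure but the completion of one. Both
issues are met by changing \<open>f\<close> on a null set, almost all of whose slices are null sets.\<close>

lemma borel_version:
  fixes f :: "real \<times> real \<Rightarrow> real"
  assumes "f \<in> borel_measurable lebesgue"
  obtains g where "g \<in> borel_measurable borel" "AE p in lebesgue. f p = g p"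
    "AE y in lborel. AE x in lborel. f (x, y) = g (x, y)"
proof -
  obtain g where g: "g \<in> borel_measurable lborel" and fg: "AE p in lborel. f p = g p"
    using completion_ex_borel_measurable_real[OF assms] by auto
  then obtain N where N: "N \<in> null_sets lborel" "{p. f p \<noteq> g p} \<subseteq> N"
    unfolding eventually_ae_filter by auto
  have Nb: "N \<in> sets (lborel \<Otimes>\<^sub>M lborel)" using N(1) by (simp only: lborel_prod null_setsD2)
  have "AE p in lborel \<Otimes>\<^sub>M lborel. p \<notin> N"
    unfolding lborel_prod using N(1) by (rule AE_not_in)
  then have "AE x in lborel. AE y in lborel. (x, y) \<notin> N" by (rule lborel_pair.AE_pair)
  \<comment> \<open>Interchanging the quantifiers needs a measurable exceptional set, hence \<open>N\<close>
    instead of the set where \<open>f\<close> and \<open>g\<close> differ.\<close>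
  then have "AE y in lborel. AE x in lborel. (x, y) \<notin> N"
  proof (subst (asm) lborel_pair.AE_commute)
    have "{p \<in> space (lborel \<Otimes>\<^sub>M lborel). (fst p, snd p) \<notin> N} = space (lborel \<Otimes>\<^sub>M lborel) - N" by auto
    then show "{p \<in> space (lborel \<Otimes>\<^sub>M lborel). (fst p, snd p) \<notin> N} \<in> sets (lborel \<Otimes>\<^sub>M lborel)"
      by (simp only:) (rule sets.compl_sets[OF Nb])
  qed
  then have "AE y in lborel. AE x in lborel. f (x, y) = g (x, y)"
  proof eventually_elim
    case (elim y)
    then show ?case by eventually_elim (use N(2) in auto)
  qed
  then show ?thesis
    using that[of g] g AE_completion[OF fg] by (simp add: measurable_lborel1)
qed


text \<open>Fubini's theorem applied to the John--Nirenberg inequality, where the square is cut down to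
the rectangle over \<open>J\<close>. When the result is divided by the width of the rectangle, only a factor
\<open>s\<close> is lost for a set \<open>J\<close> of length \<open>1\<close>.\<close>

lemma nn_integral_slices_john_nirenberg:
  fixes g :: "real \<times> real \<Rightarrow> real"
  assumes f: "locally_integrable f"
    and osc: "\<And>a b s. 0 < s \<Longrightarrow> mean_osc f (square a b s) \<le> 1"
    and \<mu>: "0 \<le> \<mu>" "exp (6 * \<mu>) \<le> 5/4" and s: "0 < s"
    and g: "g \<in> borel_measurable borel" and fg: "AE p in lebesgue. f p = g p"
    and J: "J \<subseteq> {b..b + s}"
  shows "(\<integral>\<^sup>+y\<in>J. (\<integral>\<^sup>+x\<in>{a..a + s}. ennreal (exp (\<mu> * \<bar>g (x, y) - average f (square a b s)\<bar>)) \<partial>lborel) \<partial>lborel)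
    \<le> ennreal (5 * s\<^sup>2)"
proof -
  let ?E = "\<lambda>u. ennreal (exp (\<mu> * \<bar>u - average f (square a b s)\<bar>))"
  have [measurable]: "g \<in> borel_measurable (lborel \<Otimes>\<^sub>M lborel)"
    using g by (simp add: lborel_prod)
  have [measurable]: "square a b s \<in> sets (lborel \<Otimes>\<^sub>M lborel)"
    unfolding square_eq_cbox lborel_prod by simp
  have "(\<integral>\<^sup>+y\<in>J. (\<integral>\<^sup>+x\<in>{a..a + s}. ?E (g (x, y)) \<partial>lborel) \<partial>lborel)
      \<le> (\<integral>\<^sup>+y. (\<integral>\<^sup>+x. ?E (g (x, y)) * indicator (square a b s) (x, y) \<partial>lborel) \<partial>lborel)"
  proof (rule nn_integral_mono)
    fix y
    show "(\<integral>\<^sup>+x\<in>{a..a + s}. ?E (g (x, y)) \<partial>lborel) * indicator J y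
        \<le> (\<integral>\<^sup>+x. ?E (g (x, y)) * indicator (square a b s) (x, y) \<partial>lborel)"
    proof (cases "y \<in> J")
      case True
      then show ?thesis
        using J by (auto intro!: nn_integral_mono simp: square_def split: split_indicator)
    qed simp
  qed
  also have "\<dots> = (\<integral>\<^sup>+p. ?E (g p) * indicator (square a b s) p \<partial>(lborel \<Otimes>\<^sub>M lborel))"
    by (rule lborel_pair.nn_integral_snd) measurable
  also have "\<dots> = (\<integral>\<^sup>+p\<in>square a b s. ?E (g p) \<partial>lebesgue)"
    by (simp add: lborel_prod nn_integral_completion)
  also have "\<dots> = (\<integral>\<^sup>+p\<in>square a b s. ?E (f p) \<partial>lebesgue)"
    by (rule nn_integral_cong_AE) (use fg in eventually_elim, simp)
  also have "\<dots> \<le> ennreal (5 * s\<^sup>2)"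
    by (rule john_nirenberg_square[OF f osc \<mu> s])
  finally show ?thesis .
qed

text \<open>The factor \<open>(1/8) ^ k\<close> combines \<open>(1/4) ^ k\<close> from the division of the exponent by \<open>k\<close> with
the normalisation \<open>1 / 2 ^ k\<close> of the average over \<open>S\<close>. A larger set \<open>T\<close> is admitted so that an
arbitrary interval can be replaced by a closed one.\<close>

lemma exp_scaled_mean_osc_le:
  assumes h: "h \<in> borel_measurable lebesgue" and S: "S \<in> lmeasurable" "measure lebesgue S = 2 ^ k"
    and \<mu>: "0 < \<mu>" and k: "1 \<le> k" and ST: "S \<subseteq> T"
  shows "ennreal (exp (\<mu> / 2 * (mean_osc h S / real k)))
    \<le> 4 + ennreal (4 * (1/8) ^ k) * (\<integral>\<^sup>+x\<in>T. ennreal (exp (\<mu> * \<bar>h x - c\<bar>)) \<partial>lebesgue)"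
proof -
  let ?v = "\<mu> / 2 * mean_osc h S"
  have pow: "(4::real) * (1/4) ^ k = 4 * (1/8) ^ k * 2 ^ k"
    by (simp add: power_mult_distrib[symmetric])
  have "exp (\<mu> / 2 * (mean_osc h S / real k)) = exp (?v / real k)" by simp
  also have "\<dots> \<le> 4 + 4 * (1/8) ^ k * (2 ^ k * exp ?v)"
    using exp_divide_le[OF k, of ?v] unfolding pow by (simp add: mult.assoc)
  finally have "ennreal (exp (\<mu> / 2 * (mean_osc h S / real k))) \<le> ennreal (4 + 4 * (1/8) ^ k * (2 ^ k * exp ?v))"
    by (rule ennreal_leI)
  also have "\<dots> = 4 + ennreal (4 * (1/8) ^ k) * ennreal (2 ^ k * exp ?v)"
    by (simp add: ennreal_plus ennreal_mult)
  also have "\<dots> \<le> 4 + ennreal (4 * (1/8) ^ k) * (\<integral>\<^sup>+x\<in>S. ennreal (exp (\<mu> * \<bar>h x - c\<bar>)) \<partial>lebesgue)"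
    using exp_mean_osc_le[OF h S(1) _ \<mu>, of c] S(2) by (intro add_left_mono mult_left_mono) auto
  also have "\<dots> \<le> 4 + ennreal (4 * (1/8) ^ k) * (\<integral>\<^sup>+x\<in>T. ennreal (exp (\<mu> * \<bar>h x - c\<bar>)) \<partial>lebesgue)"
    using ST by (intro add_left_mono mult_left_mono nn_set_integral_set_mono) auto
  finally show ?thesis .
qed

section \<open>Exponential integrability of the maximal slice oscillation\<close>

text \<open>The supremum is bounded by \<open>4\<close> plus a series over all \<open>k\<close>, whose terms integrate to at most
\<open>4 * (1/8) ^ k * 5 * 4 ^ k = 20 * (1/2) ^ k\<close> over \<open>J\<close>.\<close>

theorem theorem4p8:
  shows "\<exists>lam c :: real. 0 < lam \<and> 0 < c \<and>
    (\<forall>f \<in> BMO. bmo_norm f = 1 \<longrightarrow>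
      (\<forall>(I :: nat \<Rightarrow> real set) J.
        (\<forall>k\<ge>1. interval_of_length (2 ^ k) (I k)) \<longrightarrow> interval_of_length 1 J \<longrightarrow>
        (\<integral>\<^sup>+ y\<in>J. exp_ext (ereal lam *
            (SUP k\<in>{1..}. ereal (mean_osc (hslice f y) (I k) / real k))) \<partial>lebesgue)
          \<le> ennreal c))"
proof -
  define \<mu> :: real where "\<mu> = ln (5/4) / 6"
  have \<mu>: "0 < \<mu>" "exp (6 * \<mu>) \<le> 5/4" by (simp_all add: \<mu>_def)
  have "(\<integral>\<^sup>+ y\<in>J. exp_ext (ereal (\<mu> / 2) *
            (SUP k\<in>{1..}. ereal (mean_osc (hslice f y) (I k) / real k))) \<partial>lebesgue) \<le> ennreal 24"
    if fB: "f \<in> BMO" and norm: "bmo_norm f = 1"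
      and I: "\<And>k. 1 \<le> k \<Longrightarrow> interval_of_length (2 ^ k) (I k)" and J: "interval_of_length 1 J"
    for f and I :: "nat \<Rightarrow> real set" and J
  proof -
    have f: "locally_integrable f" using fB by (simp add: BMO_def)
    have osc: "mean_osc f (square a b s) \<le> 1" if "0 < s" for a b s
    proof -
      have "square a b s \<in> squares" using that unfolding squares_def square_def by blast
      then have "ereal (mean_osc f (square a b s)) \<le> bmo_norm f"
        unfolding bmo_norm_def by (rule SUP_upper)
      then show ?thesis by (simp add: norm)
    qed
    obtain b where b: "J \<subseteq> {b..b + 1}" by (rule interval_of_length_subset_Icc[OF J]) auto
    have "\<exists>a. I k \<subseteq> {a..a + 2 ^ k}" if "1 \<le> k" for k
      by (rule interval_of_length_subset_Icc[OF I[OF that]]) auto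
    then obtain a where a: "\<And>k. 1 \<le> k \<Longrightarrow> I k \<subseteq> {a k..a k + 2 ^ k}" by metis
    obtain g where g: "g \<in> borel_measurable borel" and fg: "AE p in lebesgue. f p = g p"
      and fgy: "AE y in lborel. AE x in lborel. f (x, y) = g (x, y)"
      using borel_version[OF locally_integrable_borel_measurable[OF f]] .
    have [measurable]: "g \<in> borel_measurable (lborel \<Otimes>\<^sub>M lborel)" using g by (simp add: lborel_prod)
    define c where "c = (\<lambda>k::nat. average f (square (a k) b (2 ^ k)))"
    define G where "G = (\<lambda>k y. \<integral>\<^sup>+x\<in>{a k..a k + 2 ^ k}. ennreal (exp (\<mu> * \<bar>g (x, y) - c k\<bar>)) \<partial>lborel)"
    have "G k \<in> borel_measurable lborel" for k
      unfolding G_def by measurable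
    then have [measurable]: "G k \<in> borel_measurable lebesgue" for k
      by (rule measurable_completion)
    have J_lm: "J \<in> lmeasurable" by (rule interval_of_length_lmeasurable[OF J]) simp
    then have [measurable]: "J \<in> sets lebesgue" by auto
    have pointwise: "AE y in lebesgue. exp_ext (ereal (\<mu> / 2) *
            (SUP k\<in>{1..}. ereal (mean_osc (hslice f y) (I k) / real k)))
          \<le> 4 + (\<Sum>k. ennreal (4 * (1/8) ^ Suc k) * G (Suc k) y)"
      using AE_completion[OF fgy]
    proof eventually_elim
      case (elim y)
      have slice_eq: "AE x in lebesgue. hslice f y x = g (x, y)"
        using AE_completion[OF elim] by (simp add: hslice_def)
      have "(\<lambda>x. g (x, y)) \<in> borel_measurable lborel" by measurable
      then have "(\<lambda>x. g (x, y)) \<in> borel_measurable lebesgue" by (rule measurable_completion)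
      then have h: "hslice f y \<in> borel_measurable lebesgue"
        by (rule lebesgue_measurable_cong_AE[OF _ slice_eq])
      have G_eq: "(\<integral>\<^sup>+x\<in>{a k..a k + 2 ^ k}. ennreal (exp (\<mu> * \<bar>hslice f y x - c k\<bar>)) \<partial>lebesgue) = G k y" for k
        unfolding G_def nn_integral_completion[symmetric, of lborel]
        by (rule nn_integral_cong_AE) (use slice_eq in eventually_elim, simp)
      show ?case
      proof (rule exp_ext_SUP_le)
        fix k :: nat assume k: "1 \<le> k"
        have "ennreal (exp (\<mu> / 2 * (mean_osc (hslice f y) (I k) / real k)))
            \<le> 4 + ennreal (4 * (1/8) ^ k) * G k y"
          unfolding G_eq[symmetric]
          using I[OF k] by (intro exp_scaled_mean_osc_le h \<mu> k a interval_of_length_lmeasurable)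
            (auto simp: interval_of_length_def)
        also have "\<dots> \<le> 4 + (\<Sum>k. ennreal (4 * (1/8) ^ Suc k) * G (Suc k) y)"
          using k sum_le_suminf[of "\<lambda>k. ennreal (4 * (1/8) ^ Suc k) * G (Suc k) y" "{k - 1}"]
          by (intro add_left_mono) auto
        finally show "ennreal (exp (\<mu> / 2 * (mean_osc (hslice f y) (I k) / real k)))
            \<le> 4 + (\<Sum>k. ennreal (4 * (1/8) ^ Suc k) * G (Suc k) y)" .
      qed (use \<mu> in simp)
    qed
    have G_int: "(\<integral>\<^sup>+y\<in>J. ennreal (4 * (1/8) ^ k) * G k y \<partial>lebesgue) \<le> ennreal (20 * (1/2) ^ k)" for k
    proof -
      have "(\<integral>\<^sup>+y\<in>J. ennreal (4 * (1/8) ^ k) * G k y \<partial>lebesgue)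
          = ennreal (4 * (1/8) ^ k) * (\<integral>\<^sup>+y\<in>J. G k y \<partial>lebesgue)"
        unfolding mult.assoc by (rule nn_integral_cmult) measurable
      also have "(\<integral>\<^sup>+y\<in>J. G k y \<partial>lebesgue) \<le> ennreal (5 * (2 ^ k)\<^sup>2)"
        unfolding nn_integral_completion G_def c_def
        by (intro nn_integral_slices_john_nirenberg[OF f osc _ \<mu>(2) _ g fg] order_trans[OF b]) (use \<mu> in auto)
      also have "ennreal (4 * (1/8) ^ k) * \<dots> = ennreal (20 * (1/2) ^ k)"
      proof -
        have "(1/8::real) ^ k * (2 ^ k)\<^sup>2 = (1/2) ^ k"
          by (simp add: power2_eq_square power_mult_distrib[symmetric])
        then show ?thesis by (simp add: ennreal_mult[symmetric])
      qed
      finally show ?thesis by (simp add: mult_left_mono)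
    qed
    have "(\<integral>\<^sup>+ y\<in>J. exp_ext (ereal (\<mu> / 2) *
            (SUP k\<in>{1..}. ereal (mean_osc (hslice f y) (I k) / real k))) \<partial>lebesgue)
        \<le> (\<integral>\<^sup>+y\<in>J. (4 + (\<Sum>k. ennreal (4 * (1/8) ^ Suc k) * G (Suc k) y)) \<partial>lebesgue)"
      by (rule nn_integral_mono_AE) (use pointwise in eventually_elim, auto intro: mult_right_mono)
    also have "\<dots> = (\<integral>\<^sup>+y\<in>J. 4 \<partial>lebesgue) + (\<integral>\<^sup>+y. (\<Sum>k. ennreal (4 * (1/8) ^ Suc k) * G (Suc k) y * indicator J y) \<partial>lebesgue)"
      by (subst nn_set_integral_add) auto
    also have "(\<integral>\<^sup>+y\<in>J. 4 \<partial>lebesgue) = 4"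
      using J J_lm by (simp add: nn_integral_cmult_indicator interval_of_length_def emeasure_eq_measure2)
    also have "(\<integral>\<^sup>+y. (\<Sum>k. ennreal (4 * (1/8) ^ Suc k) * G (Suc k) y * indicator J y) \<partial>lebesgue)
        = (\<Sum>k. \<integral>\<^sup>+y\<in>J. ennreal (4 * (1/8) ^ Suc k) * G (Suc k) y \<partial>lebesgue)"
      by (rule nn_integral_suminf) measurable
    also have "\<dots> \<le> (\<Sum>k. ennreal (20 * (1/2) ^ Suc k))"
      by (intro suminf_le G_int) auto
    also have "\<dots> = ennreal 20"
    proof (rule suminf_ennreal_eq)
      show "(\<lambda>k. 20 * (1/2) ^ Suc k) sums (20::real)"
        using sums_mult[OF power_half_series, of 20] by simp
    qed simp
    also have "4 + ennreal 20 = ennreal 24" by (simp flip: ennreal_numeral ennreal_plus)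
    finally show ?thesis by (simp add: add_left_mono)
  qed
  then show ?thesis
    by (intro exI[of _ "\<mu> / 2"] exI[of _ "24::real"]) (use \<mu> in auto)
qed

end
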